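(* Let $\mathcal{A}$ be an algebra over a field $F$ which is either a Novikov algebra or a bicommutative algebra. Define ideals by $H_1=\mathcal{A}$ and $H_{i+1}=\mathcal{A}\circ H_i$ for all $i\ge 1$. Then $\mathsf{Id}(\mathcal{A}_{[i]})=H_i$ for all integers $i\ge 1$. In particular, $\mathsf{Id}(\mathcal{A}_{[p]})\,\mathsf{Id}(\mathcal{A}_{[q]})\subseteq \mathsf{Id}(\mathcal{A}_{[p+q-1]})$ for all integers $p,q\ge 1$.
   Context: An algebra over a field $F$ is an $F$-vector space with a bilinear multiplication (not necessarily associative or unital); "ideal" means two-sided ideal. A (left) Novikov algebra is an algebra satisfying $(xy)z=(xz)y$ (right commutativity) and $(xy)z-x(yz)=(yx)z-y(xz)$ (left symmetry) for all $x,y,z$. A bicommutative algebra is an algebra satisfying $x(yz)=y(xz)$ (left commutativity) and $(xy)z=(xz)y$ (right commutativity) for all $x,y,z$. Write $[a,b]=ab-ba$. For subspaces $A,B$ of $\mathcal{A}$, $[A,B]$ is the linear span of all $[a,b]$ with $a\in A$, $b\in B$; $AB$ is the linear span of all $ab$ with $a\in A$, $b\in B$; $\mathsf{Id}(A)$ is the ideal of $\mathcal{A}$ generated by $A$; and $A\circ B=\mathsf{Id}([A,B])$. Define $\mathcal{A}_{[1]}=\mathcal{A}$ and $\mathcal{A}_{[i+1]}=[\mathcal{A},\mathcal{A}_{[i]}]$ for $i\ge 1$. *)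

theory Defs
  imports Complex_Main
begin

text \<open>
  The vector space underlying an algebra is the whole type \<open>'a\<close>, so the algebra itself, regarded as a
  subspace, is \<^term>\<open>UNIV\<close>.
\<close>

locale nonassoc_algebra = vector_space scale
  for scale :: "'f::field \<Rightarrow> 'a::ab_group_add \<Rightarrow> 'a" (infixr \<open>*s\<close> 75) +
  fixes mult :: "'a \<Rightarrow> 'a \<Rightarrow> 'a" (infixl \<open>\<cdot>\<close> 70)
  assumes linear_mult_right: "Vector_Spaces.linear scale scale (\<lambda>y. x \<cdot> y)"
    and linear_mult_left: "Vector_Spaces.linear scale scale (\<lambda>x. x \<cdot> y)"
begin

definition commutator :: "'a \<Rightarrow> 'a \<Rightarrow> 'a"
  where "commutator a b = a \<cdot> b - b \<cdot> a"

definition commutator_space :: "'a set \<Rightarrow> 'a set \<Rightarrow> 'a set"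
  where "commutator_space A B = span {commutator a b | a b. a \<in> A \<and> b \<in> B}"

definition product_space :: "'a set \<Rightarrow> 'a set \<Rightarrow> 'a set"
  where "product_space A B = span {a \<cdot> b | a b. a \<in> A \<and> b \<in> B}"

definition two_sided_ideal :: "'a set \<Rightarrow> bool"
  where "two_sided_ideal I \<longleftrightarrow> subspace I \<and> (\<forall>a. \<forall>x\<in>I. a \<cdot> x \<in> I \<and> x \<cdot> a \<in> I)"

definition ideal_generated :: "'a set \<Rightarrow> 'a set"
  where "ideal_generated A = two_sided_ideal hull A"

definition circ :: "'a set \<Rightarrow> 'a set \<Rightarrow> 'a set"
  where "circ A B = ideal_generated (commutator_space A B)"

text \<open>The two sequences below are indexed from \<open>1\<close>; the value at index \<open>0\<close> is a dummy.\<close>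

fun lower_central :: "nat \<Rightarrow> 'a set" where
  "lower_central 0 = UNIV"
| "lower_central (Suc 0) = UNIV"
| "lower_central (Suc (Suc n)) = commutator_space UNIV (lower_central (Suc n))"

fun H :: "nat \<Rightarrow> 'a set" where
  "H 0 = UNIV"
| "H (Suc 0) = UNIV"
| "H (Suc (Suc n)) = circ UNIV (H (Suc n))"

end

locale novikov_algebra = nonassoc_algebra +
  assumes right_commutative: "(x \<cdot> y) \<cdot> z = (x \<cdot> z) \<cdot> y"
    and left_symmetric: "(x \<cdot> y) \<cdot> z - x \<cdot> (y \<cdot> z) = (y \<cdot> x) \<cdot> z - y \<cdot> (x \<cdot> z)"

locale bicommutative_algebra = nonassoc_algebra +
  assumes left_commutative: "x \<cdot> (y \<cdot> z) = y \<cdot> (x \<cdot> z)"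
    and right_commutative: "(x \<cdot> y) \<cdot> z = (x \<cdot> z) \<cdot> y"

end

theory Submission
  imports Defs
begin

text \<open>
  Both classes of algebras are right commutative and satisfy a common weakening of left
  commutativity, \<open>x(yz) - y(xz) = \<epsilon> [x,y]z\<close> with a scalar \<open>\<epsilon>\<close>: the value \<open>\<epsilon> = 1\<close> is left symmetry
  and \<open>\<epsilon> = 0\<close> is left commutativity. The whole argument uses only these two identities.

  For ideals \<open>K\<close> and \<open>J\<close>, the elements \<open>x\<close> with \<open>[x,K] \<subseteq> J\<close> form an ideal
  (\<open>two_sided_ideal_centralizer\<close>). For \<open>K = \<A>\<close> and \<open>J = Id([\<A>,L])\<close> this ideal contains \<open>L\<close>, hence
  \<open>Id(L)\<close>, so that \<open>[\<A>,Id(L)] \<subseteq> Id([\<A>,L])\<close>. Thus taking the ideal closure at every step of the lower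
  central series, or only once at the end, gives the same ideal, which is the first claim.

  For the second claim, the Jacobi identity and the same ideal of elements centralizing \<open>K\<close> modulo
  \<open>J\<close> give \<open>[H\<^sub>p,H\<^sub>q] \<subseteq> H\<^sub>p\<^sub>+\<^sub>q\<close> by induction on \<open>p\<close>. Right commutativity alone yields the cyclic identity
  \<open>[a,h]k + [h,k]a + [k,a]h = 0\<close>. For \<open>h\<close> in \<open>H\<^sub>p\<close> and \<open>k\<close> in \<open>H\<^sub>q\<close> its middle term lies in \<open>H\<^sub>p\<^sub>+\<^sub>q\<close>, so
  modulo \<open>H\<^sub>p\<^sub>+\<^sub>q\<close> the operator \<open>[a,-]\<close> can be moved from one factor of a product to the other:
  \<open>[a,h]k \<equiv> [a,k]h\<close>. This trades \<open>H\<^sub>p\<^sub>+\<^sub>1 H\<^sub>q\<close> for \<open>H\<^sub>q\<^sub>+\<^sub>1 H\<^sub>p\<close> and drives an induction on \<open>p\<close>; there is no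
  division by \<open>2\<close>, so every characteristic is covered.
\<close>

section \<open>Ideals of nonassociative algebras\<close>

context nonassoc_algebra
begin

lemma mult_add_right: "x \<cdot> (y + z) = x \<cdot> y + x \<cdot> z"
  using Vector_Spaces.linear.axioms(3)[OF linear_mult_right] by (simp add: module_hom_iff)

lemma mult_add_left: "(x + y) \<cdot> z = x \<cdot> z + y \<cdot> z"
  using linear_mult_left by (simp add: Vector_Spaces.linear_iff)

lemma mult_scale_right: "x \<cdot> (c *s y) = c *s (x \<cdot> y)"
  using linear_mult_right by (simp add: Vector_Spaces.linear_iff)

lemma mult_scale_left: "(c *s x) \<cdot> y = c *s (x \<cdot> y)"
  using linear_mult_left by (simp add: Vector_Spaces.linear_iff)

lemma mult_zero_right: "x \<cdot> 0 = 0"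
  using mult_add_right[of x 0 0] by simp

lemma mult_zero_left: "0 \<cdot> x = 0"
  using mult_add_left[of 0 0 x] by simp

lemma mult_diff_right: "x \<cdot> (y - z) = x \<cdot> y - x \<cdot> z"
  using mult_add_right[of x "y - z" z] by simp

lemma mult_diff_left: "(x - y) \<cdot> z = x \<cdot> z - y \<cdot> z"
  using mult_add_left[of "x - y" y z] by simp

lemma two_sided_ideal_Inter:
  assumes "\<forall>I\<in>\<F>. two_sided_ideal I"
  shows "two_sided_ideal (\<Inter>\<F>)"
  using assms unfolding two_sided_ideal_def by (auto intro!: subspace_Inter)

lemma two_sided_ideal_UNIV: "two_sided_ideal UNIV"
  by (simp add: two_sided_ideal_def)

lemma two_sided_ideal_ideal_generated: "two_sided_ideal (ideal_generated A)"
  unfolding ideal_generated_def by (rule hull_in) (rule two_sided_ideal_Inter)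

lemma subset_ideal_generated: "A \<subseteq> ideal_generated A"
  unfolding ideal_generated_def by (rule hull_subset)

lemma ideal_generated_least:
  assumes "A \<subseteq> I" and "two_sided_ideal I"
  shows "ideal_generated A \<subseteq> I"
  using assms unfolding ideal_generated_def by (rule hull_minimal)

context
  fixes I assumes ideal: "two_sided_ideal I"
begin

lemma ideal_subspace: "subspace I"
  using ideal by (simp add: two_sided_ideal_def)

lemma ideal_mult_left: "x \<in> I \<Longrightarrow> a \<cdot> x \<in> I"
  using ideal by (simp add: two_sided_ideal_def)

lemma ideal_mult_right: "x \<in> I \<Longrightarrow> x \<cdot> a \<in> I"
  using ideal by (simp add: two_sided_ideal_def)

lemmas ideal_closed =
  subspace_0[OF ideal_subspace] subspace_add[OF ideal_subspace] subspace_diff[OF ideal_subspace]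
  subspace_scale[OF ideal_subspace] ideal_mult_left ideal_mult_right

lemma ideal_commutator: "x \<in> I \<Longrightarrow> commutator a x \<in> I"
  by (simp add: commutator_def ideal_closed)

end

lemma commutator_swap: "commutator a b = - commutator b a"
  by (simp add: commutator_def)

lemma subspace_commutator_swap:
  assumes "subspace S" and "commutator a b \<in> S"
  shows "commutator b a \<in> S"
  using subspace_neg[OF assms] by (simp add: commutator_swap[of b a])

lemma circ_least:
  assumes "two_sided_ideal I" and "\<And>a b. a \<in> A \<Longrightarrow> b \<in> B \<Longrightarrow> commutator a b \<in> I"
  shows "circ A B \<subseteq> I"
  unfolding circ_def commutator_space_def
  by (rule ideal_generated_least[OF _ assms(1)], rule span_minimal[OF _ ideal_subspace[OF assms(1)]])
    (use assms(2) in auto)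

lemma commutator_in_commutator_space:
  assumes "a \<in> A" and "b \<in> B"
  shows "commutator a b \<in> commutator_space A B"
  unfolding commutator_space_def by (rule span_base) (use assms in auto)

lemma commutator_in_circ:
  assumes "a \<in> A" and "b \<in> B"
  shows "commutator a b \<in> circ A B"
  using commutator_in_commutator_space[OF assms] subset_ideal_generated unfolding circ_def by blast

lemma commutator_space_mono: "B \<subseteq> C \<Longrightarrow> commutator_space A B \<subseteq> commutator_space A C"
  unfolding commutator_space_def by (rule span_mono) blast

lemma ideal_generated_mono: "A \<subseteq> B \<Longrightarrow> ideal_generated A \<subseteq> ideal_generated B"
  unfolding ideal_generated_def by (rule hull_mono)

lemma two_sided_ideal_H: "two_sided_ideal (H n)"
  by (cases n rule: H.cases)
    (simp_all add: two_sided_ideal_UNIV circ_def two_sided_ideal_ideal_generated)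

lemma H_decreasing: "H (Suc (Suc n)) \<subseteq> H (Suc n)"
  using circ_least[OF two_sided_ideal_H] ideal_commutator[OF two_sided_ideal_H] by simp

definition centralizer_mod :: "'a set \<Rightarrow> 'a set \<Rightarrow> 'a set"
  where "centralizer_mod K J = {x. \<forall>k\<in>K. commutator x k \<in> J}"

definition annihilator_mod :: "'a set \<Rightarrow> 'a set \<Rightarrow> 'a set"
  where "annihilator_mod K J = {x. \<forall>k\<in>K. x \<cdot> k \<in> J \<and> k \<cdot> x \<in> J}"

lemma commutator_linear_left:
  "commutator 0 k = 0"
  "commutator (x + y) k = commutator x k + commutator y k"
  "commutator (c *s x) k = c *s commutator x k"
  by (simp_all add: commutator_def mult_zero_left mult_zero_right mult_add_left mult_add_right
      mult_scale_left mult_scale_right scale_right_diff_distrib)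

lemma subspace_centralizer_mod: "subspace J \<Longrightarrow> subspace (centralizer_mod K J)"
  unfolding centralizer_mod_def
  by (rule subspaceI) (auto simp: commutator_linear_left subspace_0 subspace_add subspace_scale)

lemma subspace_annihilator_mod: "subspace J \<Longrightarrow> subspace (annihilator_mod K J)"
  unfolding annihilator_mod_def
  by (rule subspaceI) (auto simp: mult_zero_left mult_zero_right mult_add_left mult_add_right
      mult_scale_left mult_scale_right subspace_0 subspace_add subspace_scale)

end

section \<open>A common generalization of Novikov and bicommutative algebras\<close>

text \<open>
  The scalar \<open>\<epsilon>\<close> interpolates between bicommutative algebras, \<open>\<epsilon> = 0\<close>, and Novikov algebras, \<open>\<epsilon> = 1\<close>.
\<close>

locale twisted_novikov_algebra = nonassoc_algebra scale mult
  for scale :: "'f::field \<Rightarrow> 'a::ab_group_add \<Rightarrow> 'a" (infixr \<open>*s\<close> 75)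
    and mult :: "'a \<Rightarrow> 'a \<Rightarrow> 'a" (infixl \<open>\<cdot>\<close> 70) +
  fixes \<epsilon> :: 'f
  assumes right_commutative: "(x \<cdot> y) \<cdot> z = (x \<cdot> z) \<cdot> y"
    and twisted_left_commutative: "x \<cdot> (y \<cdot> z) = y \<cdot> (x \<cdot> z) + \<epsilon> *s (commutator x y \<cdot> z)"
begin

lemma commutator_mult_cyclic:
  "commutator a b \<cdot> c + commutator b c \<cdot> a + commutator c a \<cdot> b = 0"
  by (simp add: commutator_def mult_diff_left right_commutative[of a b c]
      right_commutative[of b c a] right_commutative[of c a b])

text \<open>
  Of the twelve products in the Jacobi sum, those of shape \<open>(xy)z\<close> form the cyclic sum above, while
  those of shape \<open>x(yz)\<close> form, up to sign, \<open>\<epsilon>\<close> times that sum by the twisted left commutativity.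
\<close>

lemma jacobi:
  "commutator (commutator a b) c = commutator a (commutator b c) - commutator b (commutator a c)"
proof -
  have right: "(a \<cdot> (b \<cdot> c) - b \<cdot> (a \<cdot> c)) + (b \<cdot> (c \<cdot> a) - c \<cdot> (b \<cdot> a)) + (c \<cdot> (a \<cdot> b) - a \<cdot> (c \<cdot> b)) = 0"
  proof -
    have "?thesis \<longleftrightarrow> \<epsilon> *s (commutator a b \<cdot> c + commutator b c \<cdot> a + commutator c a \<cdot> b) = 0"
      by (simp add: twisted_left_commutative[of a b c] twisted_left_commutative[of b c a]
          twisted_left_commutative[of c a b] scale_right_distrib)
    then show ?thesis by (simp add: commutator_mult_cyclic)
  qed
  have left: "(a \<cdot> b) \<cdot> c - (b \<cdot> a) \<cdot> c + ((b \<cdot> c) \<cdot> a - (c \<cdot> b) \<cdot> a) + ((c \<cdot> a) \<cdot> b - (a \<cdot> c) \<cdot> b) = 0"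
    using commutator_mult_cyclic[of a b c] by (simp add: commutator_def mult_diff_left)
  have "commutator (commutator a b) c
      - (commutator a (commutator b c) - commutator b (commutator a c))
    = ((a \<cdot> b) \<cdot> c - (b \<cdot> a) \<cdot> c + ((b \<cdot> c) \<cdot> a - (c \<cdot> b) \<cdot> a) + ((c \<cdot> a) \<cdot> b - (a \<cdot> c) \<cdot> b))
      - ((a \<cdot> (b \<cdot> c) - b \<cdot> (a \<cdot> c)) + (b \<cdot> (c \<cdot> a) - c \<cdot> (b \<cdot> a)) + (c \<cdot> (a \<cdot> b) - a \<cdot> (c \<cdot> b)))"
    by (simp add: commutator_def mult_diff_left mult_diff_right algebra_simps)
  then show ?thesis unfolding left right by simp
qed

section \<open>Ideals cut out by commutators and by products\<close>

text \<open>
  Although the commutator need not be a derivation of the product, the commutator of \<open>k\<close> with a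
  multiple of \<open>x\<close> can be expressed by commutators of \<open>x\<close> with \<open>k\<close> and with multiples of \<open>k\<close>; this
  makes centralizers modulo an ideal closed under multiplication.
\<close>

lemma commutator_mult_right:
  "commutator (x \<cdot> a) k
    = commutator x k \<cdot> a - commutator x (k \<cdot> a) + \<epsilon> *s (commutator x k \<cdot> a)"
proof -
  have "k \<cdot> (x \<cdot> a) = x \<cdot> (k \<cdot> a) - \<epsilon> *s (commutator x k \<cdot> a)"
    using twisted_left_commutative[of x k a] by (simp add: algebra_simps)
  then show ?thesis
    by (simp add: commutator_def mult_diff_left right_commutative[of x a k]
        right_commutative[of k a x])
qed

lemma commutator_mult_left:
  "commutator (a \<cdot> x) k
    = a \<cdot> commutator x k - commutator x (a \<cdot> k) + \<epsilon> *s (commutator x k \<cdot> a)"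
proof -
  have "k \<cdot> (a \<cdot> x) = a \<cdot> (k \<cdot> x) + \<epsilon> *s (commutator k a \<cdot> x)"
    by (rule twisted_left_commutative)
  moreover have "a \<cdot> (x \<cdot> k) = x \<cdot> (a \<cdot> k) + \<epsilon> *s (commutator a x \<cdot> k)"
    by (rule twisted_left_commutative)
  moreover
  have "\<epsilon> *s (commutator x k \<cdot> a) + \<epsilon> *s (commutator k a \<cdot> x) + \<epsilon> *s (commutator a x \<cdot> k) = 0"
    using commutator_mult_cyclic[of x k a] by (simp flip: scale_right_distrib)
  then have "\<epsilon> *s (commutator x k \<cdot> a) = - (\<epsilon> *s (commutator k a \<cdot> x)) - \<epsilon> *s (commutator a x \<cdot> k)"
    by (simp add: add_eq_0_iff2 add.assoc)
  moreover have "(a \<cdot> x) \<cdot> k = (a \<cdot> k) \<cdot> x"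
    by (rule right_commutative)
  ultimately show ?thesis
    by (simp add: commutator_def[of "a \<cdot> x"] commutator_def[of x "a \<cdot> k"]
        commutator_def[of x k] mult_diff_right)
qed

lemma two_sided_ideal_centralizer:
  assumes K: "two_sided_ideal K" and J: "two_sided_ideal J"
  shows "two_sided_ideal (centralizer_mod K J)"
proof -
  have "a \<cdot> x \<in> centralizer_mod K J \<and> x \<cdot> a \<in> centralizer_mod K J" if "x \<in> centralizer_mod K J" for a x
    using that
    by (auto simp: centralizer_mod_def commutator_mult_left[of a x] commutator_mult_right[of x a]
        ideal_closed[OF J] ideal_closed[OF K])
  then show ?thesis
    using subspace_centralizer_mod[OF ideal_subspace[OF J]] by (simp add: two_sided_ideal_def)
qed

text \<open>
  The annihilator is taken on both sides because \<open>(ax)k = (ak)x\<close> turns a product with \<open>x\<close> inside the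
  left factor into one with \<open>x\<close> as the right factor.
\<close>

lemma two_sided_ideal_annihilator:
  assumes K: "two_sided_ideal K" and J: "two_sided_ideal J"
  shows "two_sided_ideal (annihilator_mod K J)"
proof -
  have "a \<cdot> x \<in> annihilator_mod K J \<and> x \<cdot> a \<in> annihilator_mod K J" if "x \<in> annihilator_mod K J" for a x
    using that
    by (auto simp: annihilator_mod_def right_commutative[of a x] right_commutative[of x a]
        twisted_left_commutative[of _ a x] twisted_left_commutative[of _ x a]
        commutator_def mult_diff_left ideal_closed[OF J] ideal_closed[OF K])
  then show ?thesis
    using subspace_annihilator_mod[OF ideal_subspace[OF J]] by (simp add: two_sided_ideal_def)
qed

section \<open>The ideals generated by the lower central series\<close>

text \<open>
  Whatever is central modulo \<open>Id([\<A>,L])\<close> forms an ideal, so centrality passes from \<open>L\<close> to \<open>Id(L)\<close>.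
\<close>

lemma circ_UNIV_ideal_generated: "circ UNIV (ideal_generated L) = circ UNIV L"
proof
  have J: "two_sided_ideal (circ UNIV L)"
    unfolding circ_def by (rule two_sided_ideal_ideal_generated)
  have "L \<subseteq> centralizer_mod UNIV (circ UNIV L)"
    using subspace_commutator_swap[OF ideal_subspace[OF J]] commutator_in_circ[of _ UNIV _ L]
    by (auto simp: centralizer_mod_def)
  then have "ideal_generated L \<subseteq> centralizer_mod UNIV (circ UNIV L)"
    by (rule ideal_generated_least) (rule two_sided_ideal_centralizer[OF two_sided_ideal_UNIV J])
  then show "circ UNIV (ideal_generated L) \<subseteq> circ UNIV L"
    using subspace_commutator_swap[OF ideal_subspace[OF J]]
    by (intro circ_least[OF J]) (auto simp: centralizer_mod_def)
next
  show "circ UNIV L \<subseteq> circ UNIV (ideal_generated L)"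
    unfolding circ_def
    by (intro ideal_generated_mono commutator_space_mono subset_ideal_generated)
qed

lemma ideal_generated_lower_central: "ideal_generated (lower_central (Suc n)) = H (Suc n)"
proof (induction n)
  case 0
  show ?case
    using subset_ideal_generated[of UNIV] by auto
next
  case (Suc n)
  have "ideal_generated (lower_central (Suc (Suc n))) = circ UNIV (lower_central (Suc n))"
    by (simp add: circ_def)
  also have "\<dots> = circ UNIV (H (Suc n))"
    by (simp only: circ_UNIV_ideal_generated flip: Suc.IH)
  finally show ?case by simp
qed

section \<open>Commutators and products of the ideals in the series\<close>

text \<open>
  As for the lower central series of a Lie algebra, the Jacobi identity settles the generators
  \<open>[a,h]\<close> of the next ideal; the centralizer being an ideal extends this to the ideal they generate.
\<close>

lemma H_subset_centralizer: "H (Suc p) \<subseteq> centralizer_mod (H (Suc q)) (H (Suc (Suc (p + q))))"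
proof (induction p arbitrary: q)
  case 0
  show ?case
    using subspace_commutator_swap[OF ideal_subspace[OF two_sided_ideal_H], of _ _ "Suc (Suc q)"]
      commutator_in_circ[of _ UNIV _ "H (Suc q)"]
    by (auto simp: centralizer_mod_def)
next
  case (Suc p)
  let ?J = "H (Suc (Suc (Suc p + q)))"
  have "commutator a h \<in> centralizer_mod (H (Suc q)) ?J" if h: "h \<in> H (Suc p)" for a h
    unfolding centralizer_mod_def
  proof clarify
    fix k assume k: "k \<in> H (Suc q)"
    have "commutator h k \<in> H (Suc (Suc (p + q)))"
      using Suc.IH h k by (auto simp: centralizer_mod_def)
    then have "commutator a (commutator h k) \<in> ?J"
      using commutator_in_circ[of a UNIV] by simp
    moreover have "commutator a k \<in> H (Suc (Suc q))"
      using commutator_in_circ[of a UNIV k] k by simp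
    then have "commutator h (commutator a k) \<in> ?J"
      using Suc.IH[of "Suc q"] h by (auto simp: centralizer_mod_def)
    ultimately show "commutator (commutator a h) k \<in> ?J"
      unfolding jacobi[of a h k] by (rule subspace_diff[OF ideal_subspace[OF two_sided_ideal_H]])
  qed
  then show ?case
    unfolding H.simps(3)[of p]
    by (intro circ_least two_sided_ideal_centralizer two_sided_ideal_H)
qed

text \<open>
  The cyclic identity moves \<open>[a,-]\<close> from \<open>h\<close> to \<open>k\<close>, which lowers the index of the factor containing
  \<open>h\<close> at the expense of the other one; hence the induction hypothesis is needed for all \<open>q\<close>.
\<close>

lemma H_subset_annihilator: "H (Suc p) \<subseteq> annihilator_mod (H (Suc q)) (H (Suc (p + q)))"
proof (induction p arbitrary: q)
  case 0
  show ?case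
    by (auto simp: annihilator_mod_def ideal_closed[OF two_sided_ideal_H])
next
  case (Suc p)
  let ?J = "H (Suc (Suc p + q))"
  note J = ideal_closed[OF two_sided_ideal_H[of "Suc (Suc p + q)"]]
  have "commutator a h \<in> annihilator_mod (H (Suc q)) ?J" if h: "h \<in> H (Suc p)" for a h
    unfolding annihilator_mod_def
  proof clarify
    fix k assume k: "k \<in> H (Suc q)"
    have "commutator h k \<in> ?J"
      using H_subset_centralizer[of p q] h k by (auto simp: centralizer_mod_def)
    then have hk: "commutator h k \<cdot> a \<in> ?J"
      by (rule J)
    have "commutator a k \<in> H (Suc (Suc q))"
      using commutator_in_circ[of a UNIV k] k by simp
    then have ak: "commutator a k \<cdot> h \<in> ?J"
      using Suc.IH[of "Suc q"] h by (auto simp: annihilator_mod_def)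
    have "commutator a h \<cdot> k = commutator a k \<cdot> h - commutator h k \<cdot> a"
      using commutator_mult_cyclic[of a h k]
      by (simp add: commutator_def mult_diff_left algebra_simps)
    then have left: "commutator a h \<cdot> k \<in> ?J"
      using J(3)[OF ak hk] by (simp only:)
    \<comment> \<open>The product in the other order differs by a commutator, which even lies one ideal deeper.\<close>
    have "commutator a h \<in> H (Suc (Suc p))"
      using commutator_in_circ[of a UNIV h] h by simp
    then have "commutator (commutator a h) k \<in> ?J"
      using H_subset_centralizer[of "Suc p" q] H_decreasing[of "Suc p + q"] k
      by (auto simp: centralizer_mod_def simp del: H.simps)
    with left have "commutator a h \<cdot> k - commutator (commutator a h) k \<in> ?J"
      by (rule J)
    with left show "commutator a h \<cdot> k \<in> ?J \<and> k \<cdot> commutator a h \<in> ?J"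
      by (simp add: commutator_def[of "commutator a h"])
  qed
  then show ?case
    unfolding H.simps(3)[of p]
    by (intro circ_least two_sided_ideal_annihilator two_sided_ideal_H)
qed

lemma product_space_H: "product_space (H (Suc p)) (H (Suc q)) \<subseteq> H (Suc (p + q))"
  unfolding product_space_def
  by (rule span_minimal[OF _ ideal_subspace[OF two_sided_ideal_H]])
    (use H_subset_annihilator[of p q] in \<open>auto simp: annihilator_mod_def\<close>)

end

lemma (in novikov_algebra) twisted_novikov: "twisted_novikov_algebra scale mult 1"
proof unfold_locales
  fix x y z
  show "(x \<cdot> y) \<cdot> z = (x \<cdot> z) \<cdot> y"
    by (rule right_commutative)
  show "x \<cdot> (y \<cdot> z) = y \<cdot> (x \<cdot> z) + 1 *s (commutator x y \<cdot> z)"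
    using left_symmetric[of x y z] by (simp add: commutator_def mult_diff_left algebra_simps)
qed

lemma (in bicommutative_algebra) twisted_novikov: "twisted_novikov_algebra scale mult 0"
proof unfold_locales
  fix x y z
  show "(x \<cdot> y) \<cdot> z = (x \<cdot> z) \<cdot> y"
    by (rule right_commutative)
  show "x \<cdot> (y \<cdot> z) = y \<cdot> (x \<cdot> z) + 0 *s (commutator x y \<cdot> z)"
    using left_commutative[of x y z] by simp
qed

theorem theorem3p3:
  fixes scale :: "'f::field \<Rightarrow> 'a::ab_group_add \<Rightarrow> 'a"
    and mult :: "'a \<Rightarrow> 'a \<Rightarrow> 'a"
  assumes "novikov_algebra scale mult \<or> bicommutative_algebra scale mult"
  shows "(\<forall>i\<ge>1. nonassoc_algebra.ideal_generated scale mult (nonassoc_algebra.lower_central scale mult i)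
            = nonassoc_algebra.H scale mult i)
    \<and> (\<forall>p\<ge>1. \<forall>q\<ge>1.
          nonassoc_algebra.product_space scale mult
            (nonassoc_algebra.ideal_generated scale mult (nonassoc_algebra.lower_central scale mult p))
            (nonassoc_algebra.ideal_generated scale mult (nonassoc_algebra.lower_central scale mult q))
          \<subseteq> nonassoc_algebra.ideal_generated scale mult
              (nonassoc_algebra.lower_central scale mult (p + q - 1)))"
proof -
  obtain \<epsilon> where "twisted_novikov_algebra scale mult \<epsilon>"
    using assms novikov_algebra.twisted_novikov bicommutative_algebra.twisted_novikov by blast
  then interpret twisted_novikov_algebra scale mult \<epsilon> .
  have Id: "ideal_generated (lower_central i) = H i" if "i \<ge> 1" for i
    using ideal_generated_lower_central[of "i - 1"] that by simp
  have "product_space (H p) (H q) \<subseteq> H (p + q - 1)" if "p \<ge> 1" and "q \<ge> 1" for p q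
  proof -
    obtain p' q' where "p = Suc p'" and "q = Suc q'"
      using \<open>p \<ge> 1\<close> \<open>q \<ge> 1\<close> by (cases p; cases q) auto
    then show ?thesis
      using product_space_H[of p' q'] by simp
  qed
  then show ?thesis
    by (simp add: Id)
qed

end
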